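(* Let $\mathscr{G} = (\mathscr{V}, \mathscr{E})$ be a finite connected $D$-regular simple graph with $N$ vertices, let $p \in [0,1]$, and let $S$ be the number of vertices in the bond percolation cluster (with parameter $p$) of a uniformly random vertex $x$ of $\mathscr{G}$. Let $\nu = (D - 1) p$ and $R = N - 1$, and assume $\nu \neq 1$. Then $$E (S) \leq 1 + Dp \left(\frac{1 - \nu^R}{1 - \nu} \right)$$ and $$E (S^2) \leq \left(1 + Dp \left(\frac{1 - \nu^R}{1 - \nu} \right) \right)^2 + \frac{Dp (1 - p)}{(1 - \nu)^2} \left(\frac{(1 - \nu^R)(1 + \nu^{R + 1})}{1 - \nu} - 2R \nu^R \right).$$
   Context: Bond percolation with parameter $p$ on $\mathscr{G}$: each edge is independently open with probability $p$ and closed with probability $1-p$. The vertex $x$ is chosen uniformly at random from $\mathscr{V}$, independently of the states of the edges. The cluster of $x$ is $\mathscr{C}_x = \{y \in \mathscr{V} : \text{there is a path of open edges connecting } x \text{ and } y\}$ (so $x \in \mathscr{C}_x$ always), and $S = \mathrm{card}(\mathscr{C}_x)$. *)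

theory Defs
  imports "HOL-Probability.Probability" "HOL-Probability.Product_PMF"
begin

definition finite_simple_graph :: "'a set \<Rightarrow> 'a set set \<Rightarrow> bool" where
  "finite_simple_graph V E \<longleftrightarrow>
     finite V \<and> V \<noteq> {} \<and> (\<forall>e\<in>E. e \<subseteq> V \<and> card e = 2)"

definition vertex_degree :: "'a set set \<Rightarrow> 'a \<Rightarrow> nat" where
  "vertex_degree E v = card {e \<in> E. v \<in> e}"

definition regular_graph :: "'a set \<Rightarrow> 'a set set \<Rightarrow> nat \<Rightarrow> bool" where
  "regular_graph V E D \<longleftrightarrow> (\<forall>v\<in>V. vertex_degree E v = D)"

text \<open>A path is given by its list of vertices; the one-element list is the trivial path.\<close>

definition is_path :: "'a set set \<Rightarrow> 'a \<Rightarrow> 'a list \<Rightarrow> 'a \<Rightarrow> bool" where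
  "is_path F x vs y \<longleftrightarrow>
     vs \<noteq> [] \<and> hd vs = x \<and> last vs = y \<and> distinct vs \<and> successively (\<lambda>u v. {u, v} \<in> F) vs"

definition connected_graph :: "'a set \<Rightarrow> 'a set set \<Rightarrow> bool" where
  "connected_graph V E \<longleftrightarrow> (\<forall>x\<in>V. \<forall>y\<in>V. \<exists>vs. is_path E x vs y)"

text \<open>A percolation configuration \<open>\<omega>\<close> maps an edge to \<open>True\<close> if it is open and to
  \<open>False\<close> if it is closed; sets that are not edges get the dummy value \<open>False\<close>.\<close>

definition bond_percolation :: "'a set set \<Rightarrow> real \<Rightarrow> ('a set \<Rightarrow> bool) pmf" where
  "bond_percolation E p = Pi_pmf E False (\<lambda>_. bernoulli_pmf p)"

definition open_edges :: "'a set set \<Rightarrow> ('a set \<Rightarrow> bool) \<Rightarrow> 'a set set" where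
  "open_edges E \<omega> = {e \<in> E. \<omega> e}"

definition cluster :: "'a set \<Rightarrow> 'a set set \<Rightarrow> ('a set \<Rightarrow> bool) \<Rightarrow> 'a \<Rightarrow> 'a set" where
  "cluster V E \<omega> x = {y \<in> V. \<exists>vs. is_path (open_edges E \<omega>) x vs y}"

text \<open>The joint law of the configuration and the independent, uniformly chosen vertex.\<close>

definition percolation_with_vertex ::
    "'a set \<Rightarrow> 'a set set \<Rightarrow> real \<Rightarrow> (('a set \<Rightarrow> bool) \<times> 'a) pmf" where
  "percolation_with_vertex V E p = pair_pmf (bond_percolation E p) (pmf_of_set V)"

definition cluster_size :: "'a set \<Rightarrow> 'a set set \<Rightarrow> ('a set \<Rightarrow> bool) \<times> 'a \<Rightarrow> real" where
  "cluster_size V E = (\<lambda>(\<omega>, x). real (card (cluster V E \<omega> x)))"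

end

theory Submission
  imports Defs
begin

text \<open>If \<open>y\<close> and \<open>z\<close> both lie in the cluster of \<open>x\<close>, there are open self-avoiding paths from \<open>x\<close>
  to \<open>y\<close> and to \<open>z\<close> that share an initial segment and are disjoint afterwards. Hence \<open>S\<^sup>2\<close> is at
  most the number of such open forks. A fork is open with probability \<open>p\<close> to the number of its
  edges, and forks inject into pairs of non-backtracking walks of length at most \<open>R = N - 1\<close>,
  that is, into pairs of vertices of the universal cover (the \<open>D\<close>-regular tree), preserving this
  number of edges. The resulting sum over pairs of walks is the second moment of the total progeny
  of the branching process of percolation on the tree, cut off at generation \<open>R\<close>; decomposing at
  the root gives a recursion that the closed form satisfies. The first moment is treated in the
  same way with single paths.\<close>

section \<open>Neighbours and non-backtracking walks\<close>

definition nbrs :: "'a set set \<Rightarrow> 'a \<Rightarrow> 'a set" where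
  "nbrs E v = {w. {v, w} \<in> E}"

lemma nbrs_subset:
  assumes "finite_simple_graph V E"
  shows "nbrs E v \<subseteq> V"
  using assms by (auto simp: nbrs_def finite_simple_graph_def)

lemma finite_nbrs:
  assumes "finite_simple_graph V E"
  shows "finite (nbrs E v)"
  by (rule finite_subset[OF nbrs_subset[OF assms]])
    (use assms in \<open>simp add: finite_simple_graph_def\<close>)

lemma finite_edges:
  assumes "finite_simple_graph V E"
  shows "finite E"
  using assms finite_subset[of E "Pow V"] unfolding finite_simple_graph_def by auto

lemma card_nbrs:
  assumes "finite_simple_graph V E"
  shows "card (nbrs E v) = vertex_degree E v"
proof -
  have "bij_betw (\<lambda>w. {v, w}) (nbrs E v) {e \<in> E. v \<in> e}"
    unfolding bij_betw_def
  proof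
    show "inj_on (\<lambda>w. {v, w}) (nbrs E v)"
      by (auto simp: inj_on_def doubleton_eq_iff)
    show "(\<lambda>w. {v, w}) ` nbrs E v = {e \<in> E. v \<in> e}"
    proof (intro equalityI subsetI)
      fix e assume e: "e \<in> {e \<in> E. v \<in> e}"
      then have "card e = 2"
        using assms by (auto simp: finite_simple_graph_def)
      then obtain a b where "e = {a, b}"
        by (meson card_2_iff)
      with e obtain w where "e = {v, w}" by fastforce
      with e show "e \<in> (\<lambda>w. {v, w}) ` nbrs E v" by (auto simp: nbrs_def)
    qed (auto simp: nbrs_def)
  qed
  then show ?thesis
    unfolding vertex_degree_def by (rule bij_betw_same_card)
qed

text \<open>A walk is represented by the list of its vertices without the starting vertex, so that
  the length of the list is the number of steps; \<open>A\<close> is the set of vertices excluded for the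
  first step.\<close>

fun walks :: "'a set set \<Rightarrow> 'a set \<Rightarrow> 'a \<Rightarrow> nat \<Rightarrow> 'a list set" where
  "walks E A v 0 = {[]}"
| "walks E A v (Suc n) = insert [] (\<Union>w\<in>nbrs E v - A. (#) w ` walks E {v} w n)"

lemma finite_walks:
  assumes "finite_simple_graph V E"
  shows "finite (walks E A v n)"
  by (induction n arbitrary: A v) (auto simp: finite_nbrs[OF assms])

lemma sum_walks_Suc:
  fixes f :: "'a list \<Rightarrow> real"
  assumes "finite_simple_graph V E"
  shows "sum f (walks E A v (Suc n)) =
    f [] + (\<Sum>w\<in>nbrs E v - A. \<Sum>xs\<in>walks E {v} w n. f (w # xs))"
proof -
  have "sum f (walks E A v (Suc n)) =
      f [] + sum f (\<Union>w\<in>nbrs E v - A. (#) w ` walks E {v} w n)"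
    unfolding walks.simps
    by (rule sum.insert) (auto simp: finite_nbrs[OF assms] finite_walks[OF assms])
  also have "sum f (\<Union>w\<in>nbrs E v - A. (#) w ` walks E {v} w n) =
      (\<Sum>w\<in>nbrs E v - A. sum f ((#) w ` walks E {v} w n))"
    by (rule sum.UNION_disjoint) (auto simp: finite_nbrs[OF assms] finite_walks[OF assms])
  also have "\<dots> = (\<Sum>w\<in>nbrs E v - A. \<Sum>xs\<in>walks E {v} w n. f (w # xs))"
    by (simp add: sum.reindex)
  finally show ?thesis .
qed

text \<open>A self-avoiding path never backtracks: as \<open>v\<close> does not recur, the rest of
  the path respects the exclusion set \<open>{v}\<close> imposed by the recursion of
  \<open>walks\<close>.\<close>

lemma path_in_walks:
  assumes "successively (\<lambda>u w. {u, w} \<in> E) (v # xs)" "distinct (v # xs)"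
    "set xs \<inter> A = {}" "length xs \<le> n"
  shows "xs \<in> walks E A v n"
  using assms
proof (induction n arbitrary: A v xs)
  case (Suc n)
  show ?case
  proof (cases xs)
    case (Cons w ys)
    have "ys \<in> walks E {v} w n"
      using Suc.prems Cons by (intro Suc.IH) auto
    then show ?thesis
      using Suc.prems Cons by (auto simp: nbrs_def)
  qed simp
qed simp

section \<open>Weighted walks and pairs of walks\<close>

text \<open>The number of edges of the tree formed by two walks from a common root in the universal
  cover: their common initial segment is counted once.\<close>

fun fork_size :: "'a list \<Rightarrow> 'a list \<Rightarrow> nat" where
  "fork_size [] ys = length ys"
| "fork_size (x # xs) [] = Suc (length xs)"
| "fork_size (x # xs) (y # ys) =
    (if x = y then Suc (fork_size xs ys) else Suc (length xs) + Suc (length ys))"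

lemma fork_size_Nil [simp]: "fork_size xs [] = length xs"
  by (cases xs) auto

text \<open>Disjoint tails differ in their first entries or one of them is empty, so nothing beyond
  \<open>ps\<close> is counted as common.\<close>

lemma fork_size_append:
  assumes "set as \<inter> set bs = {}"
  shows "fork_size (ps @ as) (ps @ bs) = length ps + length as + length bs"
  using assms by (induction ps) (cases as; cases bs; auto)+

definition walk_sum :: "'a set set \<Rightarrow> real \<Rightarrow> 'a set \<Rightarrow> 'a \<Rightarrow> nat \<Rightarrow> real" where
  "walk_sum E p A v n = (\<Sum>xs\<in>walks E A v n. p ^ length xs)"

definition fork_sum :: "'a set set \<Rightarrow> real \<Rightarrow> 'a set \<Rightarrow> 'a \<Rightarrow> nat \<Rightarrow> real" where
  "fork_sum E p A v n = (\<Sum>xs\<in>walks E A v n. \<Sum>ys\<in>walks E A v n. p ^ fork_size xs ys)"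

section \<open>Recursions by decomposition at the root\<close>

lemma walk_sum_Suc:
  assumes G: "finite_simple_graph V E"
    and m: "\<And>w. w \<in> nbrs E v - A \<Longrightarrow> walk_sum E p {v} w n = m"
  shows "walk_sum E p A v (Suc n) = 1 + real (card (nbrs E v - A)) * p * m"
proof -
  have "walk_sum E p A v (Suc n) = 1 + (\<Sum>w\<in>nbrs E v - A. p * walk_sum E p {v} w n)"
    unfolding walk_sum_def by (subst sum_walks_Suc[OF G]) (simp add: sum_distrib_left)
  also have "\<dots> = 1 + (\<Sum>w\<in>nbrs E v - A. p * m)"
    by (intro arg_cong2[where f = "(+)"] sum.cong refl) (simp only: m)
  finally show ?thesis by simp
qed

text \<open>Pairs of walks are sorted by their first steps. Both empty gives 1; exactly one empty
  gives \<open>d * p * m\<close> twice; an equal first step is counted once and gives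
  \<open>p * q\<close>; each of the \<open>d * (d - 1)\<close> ordered pairs of different first
  steps gives two separate walks, hence \<open>p\<^sup>2 * m\<^sup>2\<close>. As \<open>m\<close>
  and \<open>q\<close> are the same for all steps, the graph enters only through
  \<open>d\<close>.\<close>

lemma fork_sum_Suc:
  assumes G: "finite_simple_graph V E"
    and m: "\<And>w. w \<in> nbrs E v - A \<Longrightarrow> walk_sum E p {v} w n = m"
    and q: "\<And>w. w \<in> nbrs E v - A \<Longrightarrow> fork_sum E p {v} w n = q"
    and d: "d = real (card (nbrs E v - A))"
  shows "fork_sum E p A v (Suc n) =
    1 + 2 * d * p * m + d * p * q + d * (d - 1) * p\<^sup>2 * m\<^sup>2"
proof -
  define B where "B = nbrs E v - A"
  have finB: "finite B"
    unfolding B_def using finite_nbrs[OF G] by simp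
  have one: "(\<Sum>w\<in>B. \<Sum>xs\<in>walks E {v} w n. p ^ Suc (length xs)) = d * p * m"
  proof -
    have "(\<Sum>w\<in>B. \<Sum>xs\<in>walks E {v} w n. p ^ Suc (length xs)) =
        (\<Sum>w\<in>B. p * walk_sum E p {v} w n)"
      unfolding walk_sum_def by (simp add: sum_distrib_left)
    also have "\<dots> = (\<Sum>w\<in>B. p * m)"
      by (intro sum.cong refl) (simp only: m B_def)
    finally show ?thesis by (simp add: d B_def)
  qed
  have cross: "(\<Sum>xs\<in>walks E {v} w n. \<Sum>ys\<in>walks E {v} w' n.
      p ^ fork_size (w # xs) (w' # ys)) = (if w = w' then p * q else p\<^sup>2 * m\<^sup>2)"
    if "w \<in> B" "w' \<in> B" for w w'
  proof (cases "w = w'")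
    case True
    have "(\<Sum>xs\<in>walks E {v} w n. \<Sum>ys\<in>walks E {v} w' n. p ^ fork_size (w # xs) (w' # ys)) =
        p * fork_sum E p {v} w n"
      unfolding fork_sum_def using True by (simp add: sum_distrib_left)
    then show ?thesis using True q that by (simp add: B_def)
  next
    case False
    have "(\<Sum>xs\<in>walks E {v} w n. \<Sum>ys\<in>walks E {v} w' n. p ^ fork_size (w # xs) (w' # ys)) =
        p\<^sup>2 * (walk_sum E p {v} w n * walk_sum E p {v} w' n)"
      unfolding walk_sum_def sum_product using False
      by (simp add: sum_distrib_left power_add power2_eq_square mult_ac)
    also have "\<dots> = p\<^sup>2 * m\<^sup>2"
      using m that by (simp add: B_def power2_eq_square)
    finally show ?thesis using False by simp
  qed
  have two: "(\<Sum>w\<in>B. \<Sum>xs\<in>walks E {v} w n. \<Sum>w'\<in>B. \<Sum>ys\<in>walks E {v} w' n.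
      p ^ fork_size (w # xs) (w' # ys)) = d * p * q + d * (d - 1) * p\<^sup>2 * m\<^sup>2"
  proof -
    have "(\<Sum>w\<in>B. \<Sum>xs\<in>walks E {v} w n. \<Sum>w'\<in>B. \<Sum>ys\<in>walks E {v} w' n.
        p ^ fork_size (w # xs) (w' # ys)) =
        (\<Sum>w\<in>B. \<Sum>w'\<in>B. \<Sum>xs\<in>walks E {v} w n. \<Sum>ys\<in>walks E {v} w' n.
        p ^ fork_size (w # xs) (w' # ys))"
      by (intro sum.cong refl sum.swap)
    also have "\<dots> = (\<Sum>w\<in>B. \<Sum>w'\<in>B. if w = w' then p * q else p\<^sup>2 * m\<^sup>2)"
      by (intro sum.cong refl cross)
    also have "\<dots> = (\<Sum>w\<in>B. p * q + (d - 1) * (p\<^sup>2 * m\<^sup>2))"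
    proof (intro sum.cong refl)
      fix w assume w: "w \<in> B"
      \<comment> \<open>This lets the truncated difference \<open>card B - 1\<close> become
        \<open>d - 1\<close> over the reals.\<close>
      then have "card B \<ge> 1"
        using finB by (metis One_nat_def Suc_leI card_gt_0_iff empty_iff)
      moreover have "(\<Sum>w'\<in>B. if w = w' then p * q else p\<^sup>2 * m\<^sup>2) =
          p * q + (\<Sum>w'\<in>B - {w}. p\<^sup>2 * m\<^sup>2)"
        unfolding sum.remove[OF finB w]
        by (intro arg_cong2[where f = "(+)"] sum.cong) auto
      ultimately show "(\<Sum>w'\<in>B. if w = w' then p * q else p\<^sup>2 * m\<^sup>2) =
          p * q + (d - 1) * (p\<^sup>2 * m\<^sup>2)"
        using finB w by (simp add: d B_def[symmetric] of_nat_diff)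
    qed
    finally show ?thesis by (simp add: d B_def algebra_simps)
  qed
  have "fork_sum E p A v (Suc n) =
      (\<Sum>ys\<in>walks E A v (Suc n). p ^ fork_size [] ys) +
      (\<Sum>w\<in>B. \<Sum>xs\<in>walks E {v} w n. \<Sum>ys\<in>walks E A v (Suc n). p ^ fork_size (w # xs) ys)"
    unfolding fork_sum_def B_def by (rule sum_walks_Suc[OF G])
  also have "\<dots> = 1 + (\<Sum>w\<in>B. \<Sum>xs\<in>walks E {v} w n. p ^ Suc (length xs)) +
      (\<Sum>w\<in>B. \<Sum>xs\<in>walks E {v} w n. p ^ Suc (length xs) +
        (\<Sum>w'\<in>B. \<Sum>ys\<in>walks E {v} w' n. p ^ fork_size (w # xs) (w' # ys)))"
    unfolding sum_walks_Suc[OF G] B_def by simp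
  also have "\<dots> = 1 + 2 * d * p * m + d * p * q + d * (d - 1) * p\<^sup>2 * m\<^sup>2"
    unfolding sum.distrib one two by simp
  finally show ?thesis .
qed

text \<open>Up to the factor \<open>\<nu>\<close>, this is the variance of the total progeny after \<open>n\<close> generations of
  a branching process with binomial offspring of mean \<open>\<nu>\<close>.\<close>

definition var_term :: "real \<Rightarrow> real \<Rightarrow> nat \<Rightarrow> real" where
  "var_term p \<nu> n = (1 - p) / (1 - \<nu>)\<^sup>2 *
     ((1 - \<nu> ^ n) * (1 + \<nu> ^ (n + 1)) / (1 - \<nu>) - 2 * real n * \<nu> ^ n)"

lemma var_term_eq:
  assumes "\<nu> \<noteq> 1"
  shows "var_term p \<nu> n = (1 - p) / (1 - \<nu>) ^ 3 *
    ((1 - \<nu> ^ n) * (1 + \<nu> * \<nu> ^ n) - 2 * real n * \<nu> ^ n * (1 - \<nu>))"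
proof -
  define d where "d = 1 - \<nu>"
  have "d \<noteq> 0" using assms by (simp add: d_def)
  then have "(1 - p) / d\<^sup>2 * (a / d - b) = (1 - p) / d ^ 3 * (a - b * d)" for a b
    by (simp add: divide_simps eval_nat_numeral)
  then show ?thesis by (simp add: var_term_def d_def)
qed

text \<open>The law of total variance at the root, with a factor \<nu> taken out: the first term is
  the variance inside the subtrees, the second comes from the variance \<nu> (1 - p) of the number
  of children, times the squared mean size of a subtree.\<close>

lemma var_term_Suc:
  assumes "\<nu> \<noteq> 1"
  shows "var_term p \<nu> (Suc n) = \<nu> * var_term p \<nu> n + (1 - p) * ((1 - \<nu> ^ Suc n) / (1 - \<nu>))\<^sup>2"
proof -
  \<comment> \<open>With \<open>\<nu> ^ n\<close> abstracted to \<open>t\<close> and the common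
    fraction to \<open>c\<close>, the recursion becomes a polynomial identity.\<close>
  define t where "t = \<nu> ^ n"
  define c where "c = (1 - p) / (1 - \<nu>) ^ 3"
  have c: "(1 - p) * (a / (1 - \<nu>))\<^sup>2 = c * (a\<^sup>2 * (1 - \<nu>))" for a
  proof -
    have "1 - \<nu> \<noteq> 0" using assms by simp
    then show ?thesis
      unfolding c_def power_divide by (simp add: divide_simps eval_nat_numeral)
  qed
  have "var_term p \<nu> (Suc n) =
      c * ((1 - \<nu> * t) * (1 + \<nu> * (\<nu> * t)) - 2 * (1 + real n) * (\<nu> * t) * (1 - \<nu>))"
    unfolding var_term_eq[OF assms] by (simp add: c_def t_def)
  also have "\<dots> = \<nu> * (c * ((1 - t) * (1 + \<nu> * t) - 2 * real n * t * (1 - \<nu>))) +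
      c * ((1 - \<nu> * t)\<^sup>2 * (1 - \<nu>))"
    by algebra
  also have "\<dots> = \<nu> * var_term p \<nu> n + (1 - p) * ((1 - \<nu> ^ Suc n) / (1 - \<nu>))\<^sup>2"
    unfolding var_term_eq[OF assms] c by (simp add: c_def t_def)
  finally show ?thesis .
qed

text \<open>A vertex entered through an edge has \<open>D - 1\<close> allowed further steps, so the
  sums follow a branching process of mean offspring \<nu>. Its mean total progeny is 1 + \<nu> + ...
  + \<nu>^n, whence the exponent \<open>Suc n\<close>; the second sum is squared mean plus
  variance.\<close>

lemma sums_below_edge:
  assumes G: "finite_simple_graph V E" and reg: "regular_graph V E D"
    and \<nu>: "\<nu> = (real D - 1) * p" "\<nu> \<noteq> 1"
    and uv: "{u, v} \<in> E"
  shows "walk_sum E p {u} v n = (1 - \<nu> ^ Suc n) / (1 - \<nu>)"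
    and "fork_sum E p {u} v n = ((1 - \<nu> ^ Suc n) / (1 - \<nu>))\<^sup>2 + \<nu> * var_term p \<nu> n"
  using uv
proof (induction n arbitrary: u v)
  case 0
  {
    case 1
    show ?case using \<nu>(2) by (simp add: walk_sum_def)
  next
    case 2
    show ?case using \<nu>(2) by (simp add: fork_sum_def var_term_def)
  }
next
  case (Suc n)
  \<comment> \<open>Here \<open>u\<close> is itself a neighbour of \<open>v\<close>, so
    \<open>D\<close> is positive and exactly one step is excluded.\<close>
  have d: "real (card (nbrs E v - {u})) = real D - 1" if uv: "{u, v} \<in> E" for u v
  proof -
    have u: "u \<in> nbrs E v" and v: "v \<in> V"
      using uv G by (auto simp: nbrs_def insert_commute finite_simple_graph_def)
    have c: "card (nbrs E v) = D"
      using card_nbrs[OF G] reg v by (simp add: regular_graph_def)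
    have "card (nbrs E v) > 0"
      using u finite_nbrs[OF G] card_gt_0_iff by blast
    then show ?thesis
      using u c by (simp add: card_Diff_singleton of_nat_diff)
  qed
  define m where "m = (1 - \<nu> ^ Suc n) / (1 - \<nu>)"
  have m: "(1 - \<nu> ^ Suc (Suc n)) / (1 - \<nu>) = 1 + \<nu> * m"
    using \<nu>(2) by (simp add: m_def field_simps)
  have IH: "walk_sum E p {v} w n = m" "fork_sum E p {v} w n = m\<^sup>2 + \<nu> * var_term p \<nu> n"
    if "w \<in> nbrs E v - {u}" for u v w
    using that Suc.IH[of v w] by (auto simp: nbrs_def m_def)
  {
    case 1
    have "walk_sum E p {u} v (Suc n) = 1 + real (card (nbrs E v - {u})) * p * m"
      by (rule walk_sum_Suc[OF G IH(1)])
    then show ?case using d[OF 1] m \<nu>(1) by simp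
  next
    case 2
    have "fork_sum E p {u} v (Suc n) = 1 + 2 * (real D - 1) * p * m
        + (real D - 1) * p * (m\<^sup>2 + \<nu> * var_term p \<nu> n)
        + (real D - 1) * (real D - 1 - 1) * p\<^sup>2 * m\<^sup>2"
      by (rule fork_sum_Suc[OF G IH(1) IH(2)]) (use d[OF 2] in auto)
    \<comment> \<open>From (D - 1)(D - 2) p^2 = \<nu>^2 - \<nu> p: completing the square leaves
      \<nu> (1 - p) m^2.\<close>
    also have "\<dots> = (1 + \<nu> * m)\<^sup>2 + \<nu> * (\<nu> * var_term p \<nu> n + (1 - p) * m\<^sup>2)"
      unfolding \<nu>(1) by algebra
    finally show ?case
      unfolding var_term_Suc[OF \<nu>(2)] m m_def[symmetric] .
  }
qed

text \<open>The root has no predecessor and hence \<open>D\<close> children; one last decomposition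
  on top of the closed forms below an edge yields the factor \<open>D * p\<close>.\<close>

lemma sums_at_root:
  assumes G: "finite_simple_graph V E" and reg: "regular_graph V E D"
    and \<nu>: "\<nu> = (real D - 1) * p" "\<nu> \<noteq> 1"
    and v: "v \<in> V"
  shows "walk_sum E p {} v n = 1 + real D * p * ((1 - \<nu> ^ n) / (1 - \<nu>))"
    and "fork_sum E p {} v n =
      (1 + real D * p * ((1 - \<nu> ^ n) / (1 - \<nu>)))\<^sup>2 + real D * p * var_term p \<nu> n"
proof -
  \<comment> \<open>A subtree of depth \<open>k\<close> below a child has mean size
    \<open>M (Suc k)\<close>, which is \<open>M n\<close> when the whole tree has depth
    \<open>n = Suc k\<close>.\<close>
  define M where "M n = (1 - \<nu> ^ n) / (1 - \<nu>)" for n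
  have d: "card (nbrs E v - {}) = D"
    using card_nbrs[OF G] reg v by (simp add: regular_graph_def)
  have below: "walk_sum E p {v} w k = M (Suc k)"
    "fork_sum E p {v} w k = (M (Suc k))\<^sup>2 + \<nu> * var_term p \<nu> k"
    if "w \<in> nbrs E v - {}" for w k
    using that sums_below_edge[OF G reg \<nu>, of v w] by (auto simp: nbrs_def M_def)
  have "walk_sum E p {} v n = 1 + real D * p * M n \<and>
      fork_sum E p {} v n = (1 + real D * p * M n)\<^sup>2 + real D * p * var_term p \<nu> n"
  proof (cases n)
    case 0
    then show ?thesis
      using \<nu>(2) by (simp add: walk_sum_def fork_sum_def var_term_def M_def)
  next
    case (Suc k)
    have "walk_sum E p {} v (Suc k) = 1 + real D * p * M (Suc k)"
      using walk_sum_Suc[OF G below(1)] d by simp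
    moreover have "fork_sum E p {} v (Suc k) = 1 + 2 * real D * p * M (Suc k)
        + real D * p * ((M (Suc k))\<^sup>2 + \<nu> * var_term p \<nu> k)
        + real D * (real D - 1) * p\<^sup>2 * (M (Suc k))\<^sup>2"
      by (rule fork_sum_Suc[OF G below]) (use d in auto)
    moreover have "\<dots> = (1 + real D * p * M (Suc k))\<^sup>2
        + real D * p * (\<nu> * var_term p \<nu> k + (1 - p) * (M (Suc k))\<^sup>2)"
      unfolding \<nu>(1) by algebra
    ultimately show ?thesis
      using var_term_Suc[OF \<nu>(2)] Suc by (simp add: M_def)
  qed
  then show "walk_sum E p {} v n = 1 + real D * p * ((1 - \<nu> ^ n) / (1 - \<nu>))"
    and "fork_sum E p {} v n =
      (1 + real D * p * ((1 - \<nu> ^ n) / (1 - \<nu>)))\<^sup>2 + real D * p * var_term p \<nu> n"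
    by (auto simp: M_def)
qed

section \<open>Edges of paths\<close>

fun path_edges :: "'a list \<Rightarrow> 'a set set" where
  "path_edges (u # v # vs) = insert {u, v} (path_edges (v # vs))"
| "path_edges _ = {}"

lemma finite_path_edges [simp]: "finite (path_edges vs)"
  by (induction vs rule: path_edges.induct) auto

lemma successively_iff_path_edges:
  "successively (\<lambda>u v. {u, v} \<in> F) vs \<longleftrightarrow> path_edges vs \<subseteq> F"
  by (induction vs rule: path_edges.induct) auto

lemma path_edges_subset_Pow: "path_edges vs \<subseteq> Pow (set vs)"
  by (induction vs rule: path_edges.induct) auto

text \<open>Of the two distinct ends of an edge only one can be the start \<open>u\<close>. Hence
  two paths from \<open>u\<close> with no other common vertex share no edge.\<close>

lemma path_edge_hits_tail:
  assumes "distinct (u # vs)" "e \<in> path_edges (u # vs)"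
  shows "e \<inter> set vs \<noteq> {}"
  using assms
proof (induction vs arbitrary: u)
  case (Cons v vs)
  show ?case
  proof (cases "e = {u, v}")
    case False
    with Cons.prems have "e \<inter> set vs \<noteq> {}"
      by (intro Cons.IH[of v]) auto
    then show ?thesis by auto
  qed simp
qed simp

text \<open>The first vertex of a self-avoiding path lies on no later edge, so each step contributes
  a new edge.\<close>

lemma card_path_edges:
  assumes "distinct (u # vs)"
  shows "card (path_edges (u # vs)) = length vs"
  using assms
proof (induction vs arbitrary: u)
  case (Cons v vs)
  then have "{u, v} \<notin> path_edges (v # vs)"
    using path_edges_subset_Pow[of "v # vs"] by auto
  with Cons show ?case by simp
qed simp

text \<open>The \<open>length ps\<close> edges of the stem \<open>ps @ [u]\<close> are peeled off
  one at a time, each being new because its first vertex does not recur. The branches then meet only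
  in \<open>u\<close> and share no edge.\<close>

lemma card_fork_edges:
  assumes "distinct (ps @ u # as @ bs)"
  shows "card (path_edges (ps @ u # as) \<union> path_edges (ps @ u # bs)) =
    length ps + length as + length bs"
  using assms
proof (induction ps)
  case Nil
  have "e \<notin> path_edges (u # bs)" if "e \<in> path_edges (u # as)" for e
  proof
    assume "e \<in> path_edges (u # bs)"
    then have "e \<inter> set bs \<noteq> {}"
      using Nil path_edge_hits_tail[of u bs e] by auto
    moreover have "e \<subseteq> set (u # as)"
      using that path_edges_subset_Pow[of "u # as"] by blast
    ultimately show False using Nil by auto
  qed
  then have "path_edges (u # as) \<inter> path_edges (u # bs) = {}" by blast
  with Nil show ?case by (simp add: card_Un_disjoint card_path_edges)
next
  case (Cons a ps)
  \<comment> \<open>The successor of \<open>a\<close> in both paths: the next stem vertex, or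
    \<open>u\<close> if \<open>ps\<close> is empty.\<close>
  define h where "h = hd (ps @ [u])"
  have step: "path_edges ((a # ps) @ u # cs) = insert {a, h} (path_edges (ps @ u # cs))" for cs
    by (cases ps) (auto simp: h_def)
  have "{a, h} \<notin> path_edges (ps @ u # as) \<union> path_edges (ps @ u # bs)"
    using Cons.prems path_edges_subset_Pow[of "ps @ u # as"]
      path_edges_subset_Pow[of "ps @ u # bs"] by auto
  with Cons show ?case unfolding step by simp
qed

section \<open>Clusters and open paths\<close>

text \<open>The edges keep the path inside \<open>V\<close>, so it has at most \<open>card V\<close>
  vertices and one step fewer. This is the origin of the cutoff R = N - 1.\<close>

lemma path_tail_in_walks:
  assumes G: "finite_simple_graph V E" and x: "x \<in> V"
    and "path_edges (x # xs) \<subseteq> E" "distinct (x # xs)"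
  shows "xs \<in> walks E {} x (card V - 1)"
proof (rule path_in_walks)
  have "set vs \<subseteq> V" if "hd vs \<in> V" "path_edges vs \<subseteq> E" for vs
    using that
  proof (induction vs rule: path_edges.induct)
    case (1 u v vs)
    then have "v \<in> V"
      using G by (auto simp: finite_simple_graph_def)
    with 1 show ?case by simp
  qed auto
  from this[of "x # xs"] have "set (x # xs) \<subseteq> V"
    using assms by simp
  then have "card (set (x # xs)) \<le> card V"
    using G by (intro card_mono) (auto simp: finite_simple_graph_def)
  then show "length xs \<le> card V - 1"
    using distinct_card[OF assms(4)] by simp
qed (use assms successively_iff_path_edges in auto)

lemma cluster_path:
  assumes "y \<in> cluster V E \<omega> x"
  obtains xs where "distinct (x # xs)" "path_edges (x # xs) \<subseteq> open_edges E \<omega>" "last (x # xs) = y"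
proof -
  obtain vs where vs: "is_path (open_edges E \<omega>) x vs y"
    using assms by (auto simp: cluster_def)
  then obtain xs where "vs = x # xs"
    by (cases vs) (auto simp: is_path_def)
  with vs show ?thesis
    by (intro that[of xs]) (auto simp: is_path_def successively_iff_path_edges)
qed

definition open_paths :: "'a set set \<Rightarrow> ('a set \<Rightarrow> bool) \<Rightarrow> 'a \<Rightarrow> 'a list set" where
  "open_paths E \<omega> x = {xs. distinct (x # xs) \<and> path_edges (x # xs) \<subseteq> open_edges E \<omega>}"

text \<open>The common stem is \<open>ps @ [u]\<close>, with \<open>u = x\<close> if
  \<open>ps\<close> is empty; either branch may be empty. The single distinctness condition makes
  both paths self-avoiding and their branches disjoint.\<close>

definition forked :: "'a \<Rightarrow> 'a list \<Rightarrow> 'a list \<Rightarrow> bool" where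
  "forked x xs ys \<longleftrightarrow> (\<exists>ps u as bs. x # xs = ps @ u # as \<and> x # ys = ps @ u # bs \<and>
     distinct (ps @ u # as @ bs))"

lemma card_forked_edges:
  assumes "forked x xs ys"
  shows "card (path_edges (x # xs) \<union> path_edges (x # ys)) = fork_size xs ys"
proof -
  obtain ps u as bs where *: "x # xs = ps @ u # as" "x # ys = ps @ u # bs"
    "distinct (ps @ u # as @ bs)"
    using assms by (auto simp: forked_def)
  \<comment> \<open>Restoring the common start \<open>x\<close> adds one; this cancels because the
    stem \<open>ps @ [u]\<close> has one vertex more than it has edges.\<close>
  have "Suc (fork_size xs ys) = fork_size ((ps @ [u]) @ as) ((ps @ [u]) @ bs)"
    using *(1,2) by (metis append.assoc append_Cons append_Nil fork_size.simps(3))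
  also have "\<dots> = Suc (length ps + length as + length bs)"
    by (subst fork_size_append) (use *(3) in auto)
  finally show ?thesis
    unfolding *(1,2) card_fork_edges[OF *(3)] by simp
qed

text \<open>Given a path to \<open>y\<close> and a path to \<open>z\<close>, follow the second one only after its last vertex
  on the first one.\<close>

lemma cluster_fork:
  assumes "y \<in> cluster V E \<omega> x" "z \<in> cluster V E \<omega> x"
  obtains xs ys where "xs \<in> open_paths E \<omega> x" "ys \<in> open_paths E \<omega> x" "forked x xs ys"
    "last (x # xs) = y" "last (x # ys) = z"
proof -
  let ?P = "successively (\<lambda>u v. {u, v} \<in> open_edges E \<omega>)"
  obtain xs where xs: "distinct (x # xs)" "?P (x # xs)" "last (x # xs) = y"
    using cluster_path[OF assms(1)] successively_iff_path_edges by metis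
  obtain zs where zs: "distinct (x # zs)" "?P (x # zs)" "last (x # zs) = z"
    using cluster_path[OF assms(2)] successively_iff_path_edges by metis
  \<comment> \<open>The start \<open>x\<close> is a common vertex, so the second path has a last
    vertex on the first.\<close>
  have "\<exists>v\<in>set (x # zs). v \<in> set (x # xs)" by auto
  from split_list_last_prop[OF this] obtain cs u bs where
    u: "x # zs = cs @ u # bs" "u \<in> set (x # xs)" "\<forall>v\<in>set bs. v \<notin> set (x # xs)"
    by blast
  obtain ps as where ps: "x # xs = ps @ u # as"
    using u(2) by (meson split_list)
  obtain ys where ys: "x # ys = ps @ u # bs"
    using ps by (cases ps) auto
  have dist: "distinct (ps @ u # as @ bs)"
    using xs(1) zs(1) u ps by auto
  have "?P (x # ys)"
    using xs(2) zs(2) unfolding u(1) ps ys by (auto simp: successively_append_iff)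
  moreover have "distinct (x # ys)"
    unfolding ys using dist by auto
  ultimately have "ys \<in> open_paths E \<omega> x"
    unfolding open_paths_def successively_iff_path_edges by blast
  moreover have "xs \<in> open_paths E \<omega> x"
    using xs by (auto simp: open_paths_def successively_iff_path_edges)
  moreover have "forked x xs ys"
    unfolding forked_def using ps ys dist by blast
  moreover have "last (x # ys) = z"
    using zs(3) unfolding ys u(1) by simp
  ultimately show ?thesis
    using that xs(3) by blast
qed

lemma open_paths_subset_walks:
  assumes "finite_simple_graph V E" "x \<in> V"
  shows "open_paths E \<omega> x \<subseteq> walks E {} x (card V - 1)"
  using path_tail_in_walks[OF assms] by (auto simp: open_paths_def open_edges_def)

lemma card_cluster_le:
  assumes "finite_simple_graph V E" "x \<in> V"
  shows "card (cluster V E \<omega> x) \<le> card (open_paths E \<omega> x)"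
proof -
  have "cluster V E \<omega> x \<subseteq> (\<lambda>xs. last (x # xs)) ` open_paths E \<omega> x"
    by (auto elim!: cluster_path simp: open_paths_def)
  then show ?thesis
    using finite_subset[OF open_paths_subset_walks[OF assms] finite_walks[OF assms(1)]]
    by (metis surj_card_le)
qed

text \<open>By \<open>cluster_fork\<close>, the endpoint pairs of open forks cover the square of the
  cluster.\<close>

lemma card_cluster_squared_le:
  assumes "finite_simple_graph V E" "x \<in> V"
  shows "(card (cluster V E \<omega> x))\<^sup>2 \<le>
    card {(xs, ys). xs \<in> open_paths E \<omega> x \<and> ys \<in> open_paths E \<omega> x \<and> forked x xs ys}"
    (is "_ \<le> card ?Q")
proof -
  have "?Q \<subseteq> open_paths E \<omega> x \<times> open_paths E \<omega> x" by auto
  then have "finite ?Q"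
    using finite_subset[OF open_paths_subset_walks[OF assms] finite_walks[OF assms(1)]]
      finite_subset by blast
  moreover have "cluster V E \<omega> x \<times> cluster V E \<omega> x \<subseteq>
      (\<lambda>(xs, ys). (last (x # xs), last (x # ys))) ` ?Q"
  proof clarify
    fix y z assume yz: "y \<in> cluster V E \<omega> x" "z \<in> cluster V E \<omega> x"
    obtain xs ys where "xs \<in> open_paths E \<omega> x" "ys \<in> open_paths E \<omega> x" "forked x xs ys"
      "last (x # xs) = y" "last (x # ys) = z"
      by (rule cluster_fork[OF yz])
    then have "(xs, ys) \<in> ?Q" "last (x # xs) = y" "last (x # ys) = z"
      by simp_all
    then show "(y, z) \<in> (\<lambda>(xs, ys). (last (x # xs), last (x # ys))) ` ?Q"
      by (intro image_eqI[where x = "(xs, ys)"]) simp_all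
  qed
  ultimately have "card (cluster V E \<omega> x \<times> cluster V E \<omega> x) \<le> card ?Q"
    by (rule surj_card_le)
  then show ?thesis by (simp add: card_cartesian_product power2_eq_square)
qed

section \<open>Expectations\<close>

lemma finite_set_bond_percolation:
  assumes "finite E"
  shows "finite (set_pmf (bond_percolation E p))"
  unfolding bond_percolation_def set_Pi_pmf[OF assms]
  using assms by (intro finite_PiE_dflt) auto

text \<open>The event is a product event that constrains only the coordinates in \<open>F\<close>;
  by independence each edge of \<open>F\<close> contributes a factor \<open>p\<close>.\<close>

lemma prob_edges_open:
  assumes "finite E" "F \<subseteq> E" "0 \<le> p" "p \<le> 1"
  shows "measure_pmf.prob (bond_percolation E p) {\<omega>. F \<subseteq> open_edges E \<omega>} = p ^ card F"
proof -
  have "{\<omega>. F \<subseteq> open_edges E \<omega>} = Pi E (\<lambda>e. if e \<in> F then {True} else UNIV)"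
    using assms(2) by (auto simp: open_edges_def Pi_def)
  then have "measure_pmf.prob (bond_percolation E p) {\<omega>. F \<subseteq> open_edges E \<omega>} =
      (\<Prod>e\<in>E. measure_pmf.prob (bernoulli_pmf p) (if e \<in> F then {True} else UNIV))"
    unfolding bond_percolation_def using measure_Pi_pmf_Pi[OF assms(1)] by simp
  also have "\<dots> = (\<Prod>e\<in>E. if e \<in> F then p else 1)"
    using assms(3,4) by (intro prod.cong refl) (auto simp: measure_pmf_single)
  also have "\<dots> = p ^ card F"
    using assms(1,2) by (simp add: prod.If_cases Int_absorb1)
  finally show ?thesis .
qed

text \<open>The count is a sum of indicators, to which linearity applies. An index with
  \<open>F i\<close> not inside \<open>E\<close> is never open and drops out.\<close>

lemma expectation_card_open_le:
  fixes F :: "'b \<Rightarrow> 'a set set"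
  assumes "finite E" "0 \<le> p" "p \<le> 1" "finite I"
    and f: "\<And>\<omega>. f \<omega> \<le> real (card {i \<in> I. F i \<subseteq> open_edges E \<omega>})"
  shows "measure_pmf.expectation (bond_percolation E p) f \<le>
    (\<Sum>i\<in>{i \<in> I. F i \<subseteq> E}. p ^ card (F i))"
proof -
  let ?M = "bond_percolation E p"
  let ?J = "{i \<in> I. F i \<subseteq> E}"
  have int: "integrable (measure_pmf ?M) g" for g :: "_ \<Rightarrow> real"
    by (rule integrable_measure_pmf_finite) (rule finite_set_bond_percolation[OF assms(1)])
  have "measure_pmf.expectation ?M f \<le>
      measure_pmf.expectation ?M (\<lambda>\<omega>. \<Sum>i\<in>?J. indicator {\<omega>. F i \<subseteq> open_edges E \<omega>} \<omega>)"
  proof (intro integral_mono int)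
    fix \<omega>
    have "{i \<in> I. F i \<subseteq> open_edges E \<omega>} = {i \<in> ?J. F i \<subseteq> open_edges E \<omega>}"
      by (auto simp: open_edges_def)
    then have "real (card {i \<in> I. F i \<subseteq> open_edges E \<omega>}) =
        (\<Sum>i\<in>?J. indicator {\<omega>. F i \<subseteq> open_edges E \<omega>} \<omega>)"
      using assms(4) by (simp add: indicator_def sum.If_cases Int_def)
    with f show "f \<omega> \<le> (\<Sum>i\<in>?J. indicator {\<omega>. F i \<subseteq> open_edges E \<omega>} \<omega>)"
      by metis
  qed
  also have "\<dots> = (\<Sum>i\<in>?J. measure_pmf.prob ?M {\<omega>. F i \<subseteq> open_edges E \<omega>})"
    by (subst Bochner_Integration.integral_sum) (auto intro: int)
  also have "\<dots> = (\<Sum>i\<in>?J. p ^ card (F i))"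
    using assms by (intro sum.cong refl prob_edges_open) auto
  finally show ?thesis .
qed

lemma expectation_cluster_le:
  assumes G: "finite_simple_graph V E" and x: "x \<in> V" and p: "0 \<le> p" "p \<le> 1"
  shows "measure_pmf.expectation (bond_percolation E p) (\<lambda>\<omega>. real (card (cluster V E \<omega> x)))
    \<le> walk_sum E p {} x (card V - 1)"
proof -
  define W where "W = walks E {} x (card V - 1)"
  define I where "I = {xs \<in> W. distinct (x # xs)}"
  have finW: "finite W"
    unfolding W_def by (rule finite_walks[OF G])
  have "open_paths E \<omega> x = {xs \<in> I. path_edges (x # xs) \<subseteq> open_edges E \<omega>}" for \<omega>
    using open_paths_subset_walks[OF G x] by (auto simp: I_def W_def open_paths_def)
  then have "measure_pmf.expectation (bond_percolation E p) (\<lambda>\<omega>. real (card (cluster V E \<omega> x)))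
      \<le> (\<Sum>xs\<in>{xs \<in> I. path_edges (x # xs) \<subseteq> E}. p ^ card (path_edges (x # xs)))"
    using card_cluster_le[OF G x] finW
    by (intro expectation_card_open_le finite_edges[OF G] p) (auto simp: I_def)
  also have "\<dots> = (\<Sum>xs\<in>{xs \<in> I. path_edges (x # xs) \<subseteq> E}. p ^ length xs)"
    by (intro sum.cong refl) (simp add: I_def card_path_edges)
  \<comment> \<open>Passing to all non-backtracking walks only adds nonnegative terms.\<close>
  also have "\<dots> \<le> (\<Sum>xs\<in>W. p ^ length xs)"
    using finW p by (intro sum_mono2) (auto simp: I_def)
  finally show ?thesis by (simp add: walk_sum_def W_def)
qed

text \<open>Forks are counted, not arbitrary pairs of paths: two paths that separate and meet again
  may share later edges, and their probability of being open can then exceed the weight given by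
  \<open>fork_size\<close>.\<close>

lemma expectation_cluster_squared_le:
  assumes G: "finite_simple_graph V E" and x: "x \<in> V" and p: "0 \<le> p" "p \<le> 1"
  shows "measure_pmf.expectation (bond_percolation E p) (\<lambda>\<omega>. (real (card (cluster V E \<omega> x)))\<^sup>2)
    \<le> fork_sum E p {} x (card V - 1)"
proof -
  define W where "W = walks E {} x (card V - 1)"
  define I where "I = {(xs, ys). (xs, ys) \<in> W \<times> W \<and> forked x xs ys}"
  define F where "F = (\<lambda>(xs, ys). path_edges (x # xs) \<union> path_edges (x # ys))"
  have finW: "finite W"
    unfolding W_def by (rule finite_walks[OF G])
  have I: "I \<subseteq> W \<times> W" by (auto simp: I_def)
  have finI: "finite I"
    using I finW finite_subset by blast
  have dist: "distinct (x # xs) \<and> distinct (x # ys)" if "forked x xs ys" for xs ys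
  proof -
    obtain ps u as bs where *: "x # xs = ps @ u # as" "x # ys = ps @ u # bs"
      "distinct (ps @ u # as @ bs)"
      using \<open>forked x xs ys\<close> by (auto simp: forked_def)
    show ?thesis unfolding *(1,2) using *(3) by auto
  qed
  have eq: "{(xs, ys). xs \<in> open_paths E \<omega> x \<and> ys \<in> open_paths E \<omega> x \<and> forked x xs ys} =
      {i \<in> I. F i \<subseteq> open_edges E \<omega>}" for \<omega>
  proof -
    have "xs \<in> open_paths E \<omega> x \<and> ys \<in> open_paths E \<omega> x \<longleftrightarrow>
        (xs, ys) \<in> W \<times> W \<and> F (xs, ys) \<subseteq> open_edges E \<omega>" if "forked x xs ys" for xs ys
      using open_paths_subset_walks[OF G x, of \<omega>] dist[OF that]
      unfolding W_def F_def open_paths_def by blast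
    then show ?thesis unfolding I_def by blast
  qed
  have "(real (card (cluster V E \<omega> x)))\<^sup>2 \<le> real (card {i \<in> I. F i \<subseteq> open_edges E \<omega>})" for \<omega>
    unfolding of_nat_power[symmetric] of_nat_le_iff eq[symmetric]
    by (rule card_cluster_squared_le[OF G x])
  then have "measure_pmf.expectation (bond_percolation E p)
      (\<lambda>\<omega>. (real (card (cluster V E \<omega> x)))\<^sup>2) \<le> (\<Sum>i\<in>{i \<in> I. F i \<subseteq> E}. p ^ card (F i))"
    by (intro expectation_card_open_le finite_edges[OF G] p finI)
  also have "\<dots> = (\<Sum>i\<in>{i \<in> I. F i \<subseteq> E}. p ^ (case i of (xs, ys) \<Rightarrow> fork_size xs ys))"
    by (intro sum.cong refl) (auto simp: I_def F_def card_forked_edges)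
  also have "\<dots> \<le> (\<Sum>i\<in>W \<times> W. p ^ (case i of (xs, ys) \<Rightarrow> fork_size xs ys))"
    using finW p I by (intro sum_mono2) auto
  also have "\<dots> = fork_sum E p {} x (card V - 1)"
    unfolding fork_sum_def W_def[symmetric] sum.cartesian_product by (simp add: case_prod_unfold)
  finally show ?thesis .
qed

section \<open>Averaging over the random vertex\<close>

lemma expectation_percolation_with_vertex_le:
  fixes h :: "('a set \<Rightarrow> bool) \<times> 'a \<Rightarrow> real"
  assumes G: "finite_simple_graph V E"
    and le: "\<And>x. x \<in> V \<Longrightarrow>
      measure_pmf.expectation (bond_percolation E p) (\<lambda>\<omega>. h (\<omega>, x)) \<le> c"
  shows "measure_pmf.expectation (percolation_with_vertex V E p) h \<le> c"
proof -
  let ?B = "bond_percolation E p"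
  have V: "finite V" "V \<noteq> {}"
    using G by (auto simp: finite_simple_graph_def)
  have finB: "finite (set_pmf ?B)"
    by (rule finite_set_bond_percolation[OF finite_edges[OF G]])
  \<comment> \<open>Drawing the vertex first turns the expectation into an average over
    \<open>x\<close> of expectations over the configuration.\<close>
  have "percolation_with_vertex V E p =
      pmf_of_set V \<bind> (\<lambda>x. map_pmf (\<lambda>\<omega>. (\<omega>, x)) ?B)"
    unfolding percolation_with_vertex_def pair_pmf_def map_pmf_def
    by (rule bind_commute_pmf)
  then have "measure_pmf.expectation (percolation_with_vertex V E p) h =
      (\<Sum>x\<in>V. pmf (pmf_of_set V) x *\<^sub>R
        measure_pmf.expectation (map_pmf (\<lambda>\<omega>. (\<omega>, x)) ?B) h)"
    using V finB by (simp only:) (intro pmf_expectation_bind, auto)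
  also have "\<dots> = (\<Sum>x\<in>V. measure_pmf.expectation ?B (\<lambda>\<omega>. h (\<omega>, x)) / real (card V))"
    using V by (intro sum.cong refl) simp
  also have "\<dots> \<le> (\<Sum>x\<in>V. c / real (card V))"
    by (intro sum_mono divide_right_mono le) auto
  also have "\<dots> = c" using V by simp
  finally show ?thesis .
qed

theorem theorem1:
  fixes V :: "'a set" and E :: "'a set set" and D N R :: nat and p \<nu> :: real
    and S :: "('a set \<Rightarrow> bool) \<times> 'a \<Rightarrow> real"
  assumes "finite_simple_graph V E"
    and "connected_graph V E"
    and "regular_graph V E D"
    and "N = card V"
    and "0 \<le> p" and "p \<le> 1"
    and "S = cluster_size V E"
    and "\<nu> = (real D - 1) * p"
    and "R = N - 1"
    and "\<nu> \<noteq> 1"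
  shows "measure_pmf.expectation (percolation_with_vertex V E p) S
           \<le> 1 + real D * p * ((1 - \<nu> ^ R) / (1 - \<nu>))
       \<and> measure_pmf.expectation (percolation_with_vertex V E p) (\<lambda>z. (S z)\<^sup>2)
           \<le> (1 + real D * p * ((1 - \<nu> ^ R) / (1 - \<nu>)))\<^sup>2
             + real D * p * (1 - p) / (1 - \<nu>)\<^sup>2
               * ((1 - \<nu> ^ R) * (1 + \<nu> ^ (R + 1)) / (1 - \<nu>) - 2 * real R * \<nu> ^ R)"
proof -
  note G = assms(1) and reg = assms(3) and p = assms(5,6) and \<nu> = assms(8,10)
  have R: "R = card V - 1" using assms(4,9) by simp
  have first: "measure_pmf.expectation (percolation_with_vertex V E p) S
      \<le> 1 + real D * p * ((1 - \<nu> ^ R) / (1 - \<nu>))"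
  proof (rule expectation_percolation_with_vertex_le[OF G])
    fix x assume x: "x \<in> V"
    show "measure_pmf.expectation (bond_percolation E p) (\<lambda>\<omega>. S (\<omega>, x))
        \<le> 1 + real D * p * ((1 - \<nu> ^ R) / (1 - \<nu>))"
      using expectation_cluster_le[OF G x p] sums_at_root(1)[OF G reg \<nu> x]
      by (simp add: assms(7) cluster_size_def R)
  qed
  have "measure_pmf.expectation (percolation_with_vertex V E p) (\<lambda>z. (S z)\<^sup>2)
      \<le> (1 + real D * p * ((1 - \<nu> ^ R) / (1 - \<nu>)))\<^sup>2 + real D * p * var_term p \<nu> R"
  proof (rule expectation_percolation_with_vertex_le[OF G])
    fix x assume x: "x \<in> V"
    show "measure_pmf.expectation (bond_percolation E p) (\<lambda>\<omega>. (S (\<omega>, x))\<^sup>2)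
        \<le> (1 + real D * p * ((1 - \<nu> ^ R) / (1 - \<nu>)))\<^sup>2 + real D * p * var_term p \<nu> R"
      using expectation_cluster_squared_le[OF G x p] sums_at_root(2)[OF G reg \<nu> x]
      by (simp add: assms(7) cluster_size_def R)
  qed
  with first show ?thesis
    by (simp add: var_term_def)
qed

end
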